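(* Let $\{G_n^*(x)\}$ (of Lucas type) and $\{G_n'(x)\}$ (of Fibonacci type) be equivalent generalized Fibonacci polynomial sequences. If $m$ and $n$ are positive integers, then $$\gcd(G'_m(x),G^*_n(x))=\begin{cases} G^*_{\gcd(m,n)}(x) & \text{if } E_2(m)>E_2(n),\\ \gcd\big(G^*_{\gcd(m,n)}(x),G^*_0(x)\big) & \text{otherwise.}\end{cases}$$
   Context: All polynomials lie in $\mathbb{Z}[x]$ and $\gcd$ denotes the greatest common divisor in $\mathbb{Z}[x]$ (determined up to sign). A generalized Fibonacci polynomial (GFP) sequence $\{G_n(x)\}_{n\ge0}$ is given by $G_0(x)=p_0(x)$, $G_1(x)=p_1(x)$ and $G_n(x)=d(x)G_{n-1}(x)+g(x)G_{n-2}(x)$ for $n\ge 2$, where $p_0(x)$ is a constant and $p_1(x),d(x),g(x)$ are nonzero polynomials in $\mathbb{Z}[x]$ with $\gcd(d(x),g(x))=1$; as in the paper it is assumed that $d(x)^2+4g(x)>0$. Let $a,b$ be the roots of $z^2-d(x)z-g(x)=0$. The sequence is of Lucas type if $p_0\ne 0$, $2p_1(x)=p_0\,d(x)$, $|p_0|\in\{1,2\}$, and $\gcd(p_0,p_1(x))=\gcd(p_0,d(x))=\gcd(p_0,g(x))=1$; then, with $\alpha=2/p_0$, $G_n=(a^n+b^n)/\alpha$ (denoted $G_n^*$). It is of Fibonacci type if $p_0=0$ and $p_1=1$; then $G_n=(a^n-b^n)/(a-b)$ (denoted $G_n'$). A Lucas-type and a Fibonacci-type sequence are equivalent if they are defined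 with the same $d(x)$ and $g(x)$. For a positive integer $n$, $E_2(n)$ is the largest integer $k$ with $2^k\mid n$. *)

theory Defs
  imports Complex_Main "HOL-Computational_Algebra.Computational_Algebra"
begin

text \<open>
  The inequality \<open>d\<^sup>2 + 4g > 0\<close> constrains the real arguments \<open>x\<close> at which \<open>d\<close> and \<open>g\<close> are
  evaluated, so that \<open>z\<^sup>2 - d(x) z - g(x)\<close> has two distinct real roots there. It cannot be meant
  for every real \<open>x\<close>, since that would exclude the Chebyshev (\<open>d = 2x\<close>, \<open>g = -1\<close>), Fermat
  (\<open>d = 3x\<close>, \<open>g = -2\<close>) and Jacobsthal (\<open>d = 1\<close>, \<open>g = 2x\<close>) families. It is therefore read as: the
  inequality holds at some real \<open>x\<close> (by continuity, on a nonempty open interval). This is implied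
  both by positivity everywhere and by positivity for all large \<open>x\<close>.
\<close>

definition pos_discriminant :: "int poly \<Rightarrow> int poly \<Rightarrow> bool" where
  "pos_discriminant d g \<longleftrightarrow> (\<exists>x::real. poly (map_poly of_int (d\<^sup>2 + 4 * g)) x > 0)"

definition is_GFP ::
  "int \<Rightarrow> int poly \<Rightarrow> int poly \<Rightarrow> int poly \<Rightarrow> (nat \<Rightarrow> int poly) \<Rightarrow> bool" where
  "is_GFP p0 p1 d g G \<longleftrightarrow>
     p1 \<noteq> 0 \<and> d \<noteq> 0 \<and> g \<noteq> 0 \<and> gcd d g = 1 \<and> pos_discriminant d g \<and>
     G 0 = [:p0:] \<and> G 1 = p1 \<and> (\<forall>n\<ge>2. G n = d * G (n - 1) + g * G (n - 2))"

definition lucas_type :: "int poly \<Rightarrow> int poly \<Rightarrow> (nat \<Rightarrow> int poly) \<Rightarrow> bool" where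
  "lucas_type d g G \<longleftrightarrow>
     (\<exists>p0 p1. is_GFP p0 p1 d g G \<and> p0 \<noteq> 0 \<and> 2 * p1 = [:p0:] * d \<and> \<bar>p0\<bar> \<in> {1, 2} \<and>
        gcd [:p0:] p1 = 1 \<and> gcd [:p0:] d = 1 \<and> gcd [:p0:] g = 1)"

definition fibonacci_type :: "int poly \<Rightarrow> int poly \<Rightarrow> (nat \<Rightarrow> int poly) \<Rightarrow> bool" where
  "fibonacci_type d g G \<longleftrightarrow> is_GFP 0 1 d g G"

definition equivalent_GFP :: "(nat \<Rightarrow> int poly) \<Rightarrow> (nat \<Rightarrow> int poly) \<Rightarrow> bool" where
  "equivalent_GFP GL GF \<longleftrightarrow> (\<exists>d g. lucas_type d g GL \<and> fibonacci_type d g GF)"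

abbreviation E2 :: "nat \<Rightarrow> nat" where
  "E2 n \<equiv> multiplicity 2 n"

end

theory Submission
  imports Defs
begin

text \<open>
  Write \<open>U\<close> for the Fibonacci-type sequence and \<open>W\<close> for the Lucas-type one. Any solution \<open>X\<close> of the
  recurrence satisfies \<open>X\<^sub>r\<^sub>+\<^sub>s = X\<^sub>r\<^sub>+\<^sub>1 U\<^sub>s + g X\<^sub>r U\<^sub>s\<^sub>-\<^sub>1\<close>, and \<open>U\<^sub>s\<close> is coprime to \<open>g U\<^sub>s\<^sub>-\<^sub>1\<close>, so
  \<open>gcd(U\<^sub>s, X\<^sub>r)\<close> depends only on \<open>r\<close> modulo \<open>s\<close>. For \<open>X = U\<close> the Euclidean algorithm on indices then
  gives \<open>gcd(U\<^sub>r, U\<^sub>s) = U\<^sub>h\<close> with \<open>h = gcd(r, s)\<close>. As \<open>W\<^sub>n\<close> divides \<open>U\<^sub>2\<^sub>n\<close>, it follows that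
  \<open>gcd(U\<^sub>m, W\<^sub>n) = gcd(U\<^sub>t, W\<^sub>n)\<close> with \<open>t = gcd(m, 2n)\<close>. Put \<open>k = gcd(m, n)\<close>. If \<open>E\<^sub>2(m) > E\<^sub>2(n)\<close>, then
  \<open>t = 2k\<close> and \<open>n\<close> is \<open>k\<close> modulo \<open>2k\<close>, so the index \<open>n\<close> can be replaced by \<open>k\<close>, and \<open>W\<^sub>k\<close> divides
  \<open>U\<^sub>2\<^sub>k\<close>. Otherwise \<open>t = k\<close> and \<open>n\<close> can be replaced by \<open>0\<close>; finally \<open>gcd(U\<^sub>k, W\<^sub>0) = gcd(W\<^sub>k, W\<^sub>0)\<close>
  because \<open>W\<^sub>k\<close> is \<open>W\<^sub>1 U\<^sub>k\<close> modulo \<open>W\<^sub>0\<close>, with \<open>W\<^sub>0\<close> and \<open>W\<^sub>1\<close> coprime.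
\<close>

lemma prime_dvd_div_gcd_iff:
  fixes p m n :: "'a :: factorial_semiring_gcd"
  assumes "prime p" "m \<noteq> 0" "n \<noteq> 0"
  shows "p dvd m div gcd m n \<longleftrightarrow> multiplicity p n < multiplicity p m"
proof -
  define k where "k = gcd m n"
  have m_eq: "m = k * (m div k)"
    by (simp add: k_def)
  with assms(2) have nonzero: "k \<noteq> 0" "m div k \<noteq> 0"
    by auto
  have "multiplicity p m = multiplicity p k + multiplicity p (m div k)"
    using assms(1) nonzero
    by (subst m_eq) (simp add: prime_elem_multiplicity_mult_distrib del: dvd_mult_div_cancel)
  moreover have "multiplicity p k = min (multiplicity p m) (multiplicity p n)"
    using assms by (simp add: k_def multiplicity_gcd)
  moreover have "p dvd m div k \<longleftrightarrow> 0 < multiplicity p (m div k)"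
    using assms(1) nonzero by (simp add: prime_multiplicity_gt_zero_iff)
  ultimately show ?thesis
    unfolding k_def[symmetric] by linarith
qed

lemma gcd_prime_mult_right:
  fixes p m n :: "'a :: {factorial_semiring_gcd, semiring_gcd_mult_normalize}"
  assumes "prime p" "m \<noteq> 0" "n \<noteq> 0"
  shows "gcd m (p * n) =
    (if multiplicity p n < multiplicity p m then p * gcd m n else gcd m n)"
proof -
  define k a b where "k = gcd m n" and "a = m div k" and "b = n div k"
  have m_eq: "m = k * a" and n_eq: "n = k * b"
    by (simp_all add: k_def a_def b_def)
  have "coprime a b"
    unfolding a_def b_def k_def using assms(2) by (intro div_gcd_coprime) simp
  have "gcd m (p * n) = gcd (k * a) (k * (p * b))"
    by (simp only: m_eq n_eq mult.left_commute)
  also have "\<dots> = k * gcd a (p * b)"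
    by (simp add: gcd_mult_left normalize_mult k_def)
  also have "gcd a (p * b) = gcd a p"
    using \<open>coprime a b\<close> by (rule gcd_mult_right_right_cancel)
  also have "gcd a p = (if p dvd a then p else 1)"
    using assms(1) prime_imp_coprime[of p a]
    by (auto simp: gcd_proj2_if_dvd normalize_prime coprime_iff_gcd_eq_1 gcd.commute)
  finally show ?thesis
    using prime_dvd_div_gcd_iff[OF assms] by (simp add: k_def a_def mult.commute)
qed

lemma mod_double_gcd_if_multiplicity_less:
  fixes m n :: nat
  assumes "n > 0" "multiplicity 2 n < multiplicity 2 m"
  shows "n mod (2 * gcd m n) = gcd m n"
proof -
  define b where "b = n div gcd m n"
  have "m > 0"
    using assms(2) by (auto intro: gr0I)
  then have "\<not> 2 dvd n div gcd n m"
    using prime_dvd_div_gcd_iff[of 2 n m] assms by simp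
  then have "b mod 2 = 1"
    by (simp add: b_def gcd.commute odd_iff_mod_2_eq_one)
  moreover have "n = gcd m n * b"
    by (simp add: b_def)
  ultimately show ?thesis
    by (metis mult.commute mult.right_neutral mult_mod_right)
qed

definition satisfies_recurrence :: "'a :: semiring_0 \<Rightarrow> 'a \<Rightarrow> (nat \<Rightarrow> 'a) \<Rightarrow> bool" where
  "satisfies_recurrence d g X \<longleftrightarrow> (\<forall>n. X (Suc (Suc n)) = d * X (Suc n) + g * X n)"

locale fibonacci_sequence =
  fixes d g :: "'a :: comm_ring_1" and U :: "nat \<Rightarrow> 'a"
  assumes recurrence_U: "satisfies_recurrence d g U"
    and U_0 [simp]: "U 0 = 0"
    and U_1 [simp]: "U (Suc 0) = 1"
begin

lemma U_Suc_Suc: "U (Suc (Suc n)) = d * U (Suc n) + g * U n"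
  using recurrence_U by (simp add: satisfies_recurrence_def)

lemma recurrence_add_Suc:
  assumes "satisfies_recurrence d g X"
  shows "X (r + Suc s) = X (Suc r) * U (Suc s) + g * X r * U s"
proof (induction s arbitrary: r)
  case 0
  then show ?case by simp
next
  case (Suc s)
  from Suc[of "Suc r"] assms show ?case
    by (simp add: satisfies_recurrence_def U_Suc_Suc algebra_simps)
qed

lemma recurrence_eq_initial_values:
  assumes "satisfies_recurrence d g X"
  shows "X n = X 0 * U (Suc n) + (X 1 - d * X 0) * U n"
proof (cases n)
  case (Suc s)
  then show ?thesis
    using recurrence_add_Suc[OF assms, of 0 s] by (simp add: U_Suc_Suc algebra_simps)
qed simp

lemma U_double:
  assumes "satisfies_recurrence d g X" and "a * X 0 = 2" and "a * X 1 = d"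
  shows "U (2 * n) = a * X n * U n"
proof (cases n)
  case (Suc s)
  have "a * X n = a * X 0 * U (Suc n) + (a * X 1 - d * (a * X 0)) * U n"
    by (subst recurrence_eq_initial_values[OF assms(1)]) (simp add: algebra_simps)
  then have a_X: "a * X n = 2 * U (Suc n) - d * U n"
    by (simp only: assms(2,3)) (simp add: algebra_simps)
  have "U (2 * n) = U (Suc n) * U n + g * U n * U s"
    using recurrence_add_Suc[OF recurrence_U, of n s] by (simp add: Suc mult_2)
  also have "\<dots> = (2 * U (Suc n) - d * U n) * U n"
    by (simp add: Suc U_Suc_Suc algebra_simps)
  finally show ?thesis
    by (simp only: a_X)
qed simp

end

locale coprime_fibonacci_sequence = fibonacci_sequence d g U
  for d g :: "'a :: ring_gcd" and U +
  assumes coprime_d_g: "coprime d g"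
begin

lemma coprime_U_Suc_g: "coprime (U (Suc n)) g"
proof (induction n)
  case (Suc n)
  have "gcd g (U (Suc (Suc n))) = gcd g (d * U (Suc n))"
    using gcd_add_mult[of g "U n" "d * U (Suc n)"] by (simp add: U_Suc_Suc ac_simps)
  also have "\<dots> = 1"
    using Suc coprime_d_g by (simp add: coprime_commute)
  finally show ?case
    by (simp add: coprime_iff_gcd_eq_1 gcd.commute)
qed simp

lemma coprime_U_U_Suc: "coprime (U n) (U (Suc n))"
proof (induction n)
  case (Suc n)
  have "gcd (U (Suc n)) (U (Suc (Suc n))) = gcd (U (Suc n)) (g * U n)"
    by (simp only: U_Suc_Suc[of n] gcd_add_mult)
  also have "\<dots> = 1"
    using Suc coprime_U_Suc_g by (simp add: coprime_commute)
  finally show ?case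
    by (simp add: coprime_iff_gcd_eq_1)
qed simp

lemma gcd_U_recurrence_add:
  assumes "satisfies_recurrence d g X"
  shows "gcd (U s) (X (r + s)) = gcd (U s) (X r)"
proof (cases s)
  case (Suc t)
  have "gcd (U s) (X (r + s)) = gcd (U s) (X (Suc r) * U s + X r * (g * U t))"
    by (simp only: Suc recurrence_add_Suc[OF assms] ac_simps)
  also have "\<dots> = gcd (U s) (X r * (g * U t))"
    by (rule gcd_add_mult)
  also have "\<dots> = gcd (U s) (X r)"
    using coprime_U_Suc_g[of t] coprime_U_U_Suc[of t]
    by (intro gcd_mult_right_right_cancel) (simp add: Suc coprime_commute)
  finally show ?thesis .
qed simp

lemma gcd_U_recurrence_mod:
  assumes "satisfies_recurrence d g X"
  shows "gcd (U s) (X (r mod s)) = gcd (U s) (X r)"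
proof -
  have "gcd (U s) (X (r mod s + q * s)) = gcd (U s) (X (r mod s))" for q
  proof (induction q)
    case (Suc q)
    then show ?case
      using gcd_U_recurrence_add[OF assms, of s "r mod s + q * s"] by (simp add: ac_simps)
  qed simp
  from this[of "r div s"] show ?thesis
    by simp
qed

theorem gcd_U_U: "gcd (U m) (U n) = normalize (U (gcd m n))"
proof (induction m n rule: gcd_nat_induct)
  case (step m n)
  have "gcd (U m) (U n) = gcd (U n) (U (m mod n))"
    by (simp add: gcd_U_recurrence_mod[OF recurrence_U] gcd.commute)
  with step show ?case
    by (simp add: gcd_red_nat[of m n])
qed simp

lemma gcd_recurrence_initial_value:
  assumes "satisfies_recurrence d g X" and "coprime (X 0) (X 1)"
  shows "gcd (X n) (X 0) = gcd (U n) (X 0)"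
proof -
  have "X n = (U (Suc n) - d * U n) * X 0 + U n * X 1"
    by (subst recurrence_eq_initial_values[OF assms(1)]) (simp add: algebra_simps)
  then have "gcd (X 0) (X n) = gcd (X 0) (U n * X 1)"
    by (simp only: gcd_add_mult)
  also have "\<dots> = gcd (X 0) (U n)"
    using assms(2) by (rule gcd_mult_right_right_cancel)
  finally show ?thesis
    by (simp add: gcd.commute)
qed

context
  fixes W :: "nat \<Rightarrow> 'a" and a :: 'a
  assumes recurrence_W: "satisfies_recurrence d g W"
    and normalization_W: "a * W 0 = 2" "a * W 1 = d"
begin

lemma W_dvd_U_double: "W n dvd U (2 * n)"
  using U_double[OF recurrence_W normalization_W] by simp

lemma gcd_U_W_eq_gcd_U_gcd: "gcd (U m) (W n) = gcd (U (gcd m (2 * n))) (W n)"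
proof -
  have "gcd (U m) (W n) = gcd (U m) (gcd (U (2 * n)) (W n))"
    using W_dvd_U_double by (simp add: gcd_proj2_if_dvd)
  also have "\<dots> = gcd (gcd (U m) (U (2 * n))) (W n)"
    by (simp only: gcd.assoc)
  finally show ?thesis
    by (simp add: gcd_U_U)
qed

theorem gcd_U_W_if_multiplicity_less:
  assumes "n > 0" "multiplicity 2 n < multiplicity 2 m"
  shows "gcd (U m) (W n) = normalize (W (gcd m n))"
proof -
  define k where "k = gcd m n"
  have "m > 0"
    using assms(2) by (auto intro: gr0I)
  then have "gcd (U m) (W n) = gcd (U (2 * k)) (W n)"
    using gcd_U_W_eq_gcd_U_gcd[of m n] gcd_prime_mult_right[of 2 m n] assms
    by (simp add: k_def)
  also have "\<dots> = gcd (U (2 * k)) (W (n mod (2 * k)))"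
    by (rule gcd_U_recurrence_mod[OF recurrence_W, symmetric])
  also have "n mod (2 * k) = k"
    unfolding k_def using assms by (rule mod_double_gcd_if_multiplicity_less)
  also have "gcd (U (2 * k)) (W k) = normalize (W k)"
    using W_dvd_U_double by (rule gcd_proj2_if_dvd)
  finally show ?thesis
    by (simp only: k_def)
qed

theorem gcd_U_W_if_multiplicity_le:
  assumes "m > 0" "n > 0" "multiplicity 2 m \<le> multiplicity 2 n"
    and "coprime (W 0) (W 1)"
  shows "gcd (U m) (W n) = gcd (W (gcd m n)) (W 0)"
proof -
  define k where "k = gcd m n"
  have "gcd (U m) (W n) = gcd (U k) (W n)"
    using gcd_U_W_eq_gcd_U_gcd[of m n] gcd_prime_mult_right[of 2 m n] assms
    by (simp add: k_def)
  also have "\<dots> = gcd (U k) (W (n mod k))"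
    by (rule gcd_U_recurrence_mod[OF recurrence_W, symmetric])
  also have "n mod k = 0"
    by (simp add: k_def)
  also have "gcd (U k) (W 0) = gcd (W k) (W 0)"
    using recurrence_W assms(4) by (rule gcd_recurrence_initial_value[symmetric])
  finally show ?thesis
    by (simp only: k_def)
qed

end

end

lemma is_GFP_imp_satisfies_recurrence:
  assumes "is_GFP p0 p1 d g G"
  shows "satisfies_recurrence d g G"
  unfolding satisfies_recurrence_def
proof
  fix n
  show "G (Suc (Suc n)) = d * G (Suc n) + g * G n"
    using assms unfolding is_GFP_def by (elim conjE allE[of _ "Suc (Suc n)"]) simp
qed

lemma fibonacci_type_imp_coprime_fibonacci_sequence:
  assumes "fibonacci_type d g G"
  shows "coprime_fibonacci_sequence d g G"
  using assms is_GFP_imp_satisfies_recurrence[of 0 1 d g G]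
  by unfold_locales (simp_all add: fibonacci_type_def is_GFP_def coprime_iff_gcd_eq_1)

lemma lucas_typeE:
  assumes "lucas_type d g G"
  obtains a where "satisfies_recurrence d g G" "coprime (G 0) (G 1)" "a * G 0 = 2" "a * G 1 = d"
proof -
  obtain p0 p1 where GFP: "is_GFP p0 p1 d g G" and "p0 \<noteq> 0" "2 * p1 = [:p0:] * d"
    and "\<bar>p0\<bar> \<in> {1, 2}" "gcd [:p0:] p1 = 1"
    using assms unfolding lucas_type_def by metis
  from GFP have initial: "G 0 = [:p0:]" "G 1 = p1"
    by (simp_all add: is_GFP_def)
  have "\<bar>p0\<bar> dvd 2"
    using \<open>\<bar>p0\<bar> \<in> {1, 2}\<close> by (auto simp del: abs_dvd_iff)
  then obtain b where "2 = p0 * b"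
    unfolding abs_dvd_iff by (rule dvdE)
  then have a_G_0: "[:b:] * G 0 = 2"
    by (simp add: initial numeral_poly mult.commute)
  have "G 0 * ([:b:] * G 1) = G 0 * d"
    using \<open>2 * p1 = [:p0:] * d\<close> a_G_0 initial by (metis mult.assoc mult.commute)
  moreover have "G 0 \<noteq> 0"
    using \<open>p0 \<noteq> 0\<close> initial by simp
  ultimately have "[:b:] * G 1 = d"
    by (metis mult_left_cancel)
  with that[of "[:b:]"] show thesis
    using is_GFP_imp_satisfies_recurrence[OF GFP] a_G_0 initial \<open>gcd [:p0:] p1 = 1\<close>
    by (simp add: coprime_iff_gcd_eq_1)
qed

theorem theorem18:
  fixes GL GF :: "nat \<Rightarrow> int poly" and m n :: nat
  assumes "equivalent_GFP GL GF"
    and "m > 0" and "n > 0"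
  shows "gcd (GF m) (GL n) =
    (if E2 m > E2 n then normalize (GL (gcd m n))
     else gcd (GL (gcd m n)) (GL 0))"
proof -
  obtain d g where lucas: "lucas_type d g GL" and fibonacci: "fibonacci_type d g GF"
    using assms(1) by (auto simp: equivalent_GFP_def)
  obtain a where GL: "satisfies_recurrence d g GL" "a * GL 0 = 2" "a * GL 1 = d"
    and coprime: "coprime (GL 0) (GL 1)"
    using lucas by (rule lucas_typeE)
  interpret coprime_fibonacci_sequence d g GF
    using fibonacci by (rule fibonacci_type_imp_coprime_fibonacci_sequence)
  show ?thesis
    using gcd_U_W_if_multiplicity_less[OF GL assms(3)]
      gcd_U_W_if_multiplicity_le[OF GL assms(2,3) _ coprime]
    by simp
qed

end
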